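(* If $G$ and $H$ are isoclinic finite groups then $\kappa(G)|G| = \kappa(H)|H|$.
   Context: For a finite group $G$, $\kappa(G)$ denotes the probability that $g$ and $h$ are conjugate in $G$, when $g,h\in G$ are chosen independently and uniformly at random from $G$. For a group $G$ write $\overline{G} = G/Z(G)$, where $Z(G)$ is the centre of $G$, and let $G'$ be the derived subgroup of $G$. Define $f_G : \overline{G}\times\overline{G} \to G'$ by $f_G(g_1Z(G), g_2Z(G)) = [g_1,g_2]$ for $g_1,g_2\in G$ (this is well defined). Two finite groups $G$ and $H$ are isoclinic if there exist group isomorphisms $\alpha : \overline{G}\to\overline{H}$ and $\beta : G'\to H'$ such that $\beta(f_G(x,y)) = f_H(\alpha(x),\alpha(y))$ for all $x,y\in\overline{G}$. *)

theory Defs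
  imports "HOL-Probability.Probability" "HOL-Algebra.Generated_Groups"
begin

definition center :: "('a, 'c) monoid_scheme \<Rightarrow> 'a set" where
  "center G = {z \<in> carrier G. \<forall>g \<in> carrier G. z \<otimes>\<^bsub>G\<^esub> g = g \<otimes>\<^bsub>G\<^esub> z}"

definition conjugate :: "('a, 'c) monoid_scheme \<Rightarrow> 'a \<Rightarrow> 'a \<Rightarrow> bool" where
  "conjugate G g h \<longleftrightarrow> (\<exists>x \<in> carrier G. h = x \<otimes>\<^bsub>G\<^esub> g \<otimes>\<^bsub>G\<^esub> inv\<^bsub>G\<^esub> x)"

definition kappa :: "('a, 'c) monoid_scheme \<Rightarrow> real" where
  "kappa G = measure_pmf.prob
     (pair_pmf (pmf_of_set (carrier G)) (pmf_of_set (carrier G)))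
     {(g, h). conjugate G g h}"

(* The convention [g, h] = g h g^-1 h^-1 is the one used by derived_set in HOL-Algebra.
   Using g^-1 h^-1 g h instead gives the same derived subgroup and the same notion of
   isoclinism, because [g^-1, h^-1] is the commutator in the other convention and group
   isomorphisms commute with inverses. *)
definition commutator :: "('a, 'c) monoid_scheme \<Rightarrow> 'a \<Rightarrow> 'a \<Rightarrow> 'a" where
  "commutator G g h = g \<otimes>\<^bsub>G\<^esub> h \<otimes>\<^bsub>G\<^esub> inv\<^bsub>G\<^esub> g \<otimes>\<^bsub>G\<^esub> inv\<^bsub>G\<^esub> h"

abbreviation center_quotient :: "('a, 'c) monoid_scheme \<Rightarrow> 'a set monoid" where
  "center_quotient G \<equiv> G Mod center G"

abbreviation derived_group :: "('a, 'c) monoid_scheme \<Rightarrow> ('a, 'c) monoid_scheme" where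
  "derived_group G \<equiv> G\<lparr>carrier := derived G (carrier G)\<rparr>"

(* The arguments are cosets of the centre. The description is legitimate on such arguments:
   commutator_map_coset below computes the value from arbitrary representatives. *)
definition commutator_map :: "('a, 'c) monoid_scheme \<Rightarrow> 'a set \<Rightarrow> 'a set \<Rightarrow> 'a" where
  "commutator_map G X Y = (THE c. \<exists>g \<in> X. \<exists>h \<in> Y. c = commutator G g h)"

definition isoclinic :: "('a, 'c) monoid_scheme \<Rightarrow> ('b, 'd) monoid_scheme \<Rightarrow> bool" where
  "isoclinic G H \<longleftrightarrow>
     (\<exists>\<alpha> \<in> iso (center_quotient G) (center_quotient H).
      \<exists>\<beta> \<in> iso (derived_group G) (derived_group H).
        \<forall>x \<in> carrier (center_quotient G). \<forall>y \<in> carrier (center_quotient G).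
          \<beta> (commutator_map G x y) = commutator_map H (\<alpha> x) (\<alpha> y))"

context group
begin

lemma center_subgroup: "subgroup (center G) G"
proof (rule subgroupI)
  show "center G \<subseteq> carrier G" by (auto simp: center_def)
  have "\<one> \<in> center G" by (auto simp: center_def)
  then show "center G \<noteq> {}" by blast
next
  fix a assume "a \<in> center G"
  then have a: "a \<in> carrier G" "\<And>g. g \<in> carrier G \<Longrightarrow> a \<otimes> g = g \<otimes> a"
    by (auto simp: center_def)
  have "inv a \<otimes> g = g \<otimes> inv a" if g: "g \<in> carrier G" for g
  proof -
    have "inv a \<otimes> g = inv a \<otimes> (g \<otimes> a) \<otimes> inv a" using a(1) g by (simp add: m_assoc)
    also have "\<dots> = inv a \<otimes> (a \<otimes> g) \<otimes> inv a" using a(2)[OF g] by simp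
    also have "\<dots> = g \<otimes> inv a" using a(1) g by (simp add: m_assoc[symmetric])
    finally show ?thesis .
  qed
  then show "inv a \<in> center G" using a(1) by (simp add: center_def)
next
  fix a b assume "a \<in> center G" "b \<in> center G"
  then have a: "a \<in> carrier G" "\<And>g. g \<in> carrier G \<Longrightarrow> a \<otimes> g = g \<otimes> a"
    and b: "b \<in> carrier G" "\<And>g. g \<in> carrier G \<Longrightarrow> b \<otimes> g = g \<otimes> b"
    by (auto simp: center_def)
  have "a \<otimes> b \<otimes> g = g \<otimes> (a \<otimes> b)" if g: "g \<in> carrier G" for g
  proof -
    have "a \<otimes> b \<otimes> g = a \<otimes> g \<otimes> b" using a(1) b g by (simp add: m_assoc)
    also have "\<dots> = g \<otimes> (a \<otimes> b)" using a b(1) g by (simp add: m_assoc)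
    finally show ?thesis .
  qed
  then show "a \<otimes> b \<in> center G" using a(1) b(1) by (simp add: center_def)
qed

lemma center_normal: "center G \<lhd> G"
proof (rule normal_invI[OF center_subgroup])
  fix x h assume x: "x \<in> carrier G" and h: "h \<in> center G"
  have hc: "h \<in> carrier G" "h \<otimes> x = x \<otimes> h" using h x by (auto simp: center_def)
  have "x \<otimes> h \<otimes> inv x = h" using hc x by (metis inv_closed m_assoc r_inv r_one)
  then show "x \<otimes> h \<otimes> inv x \<in> center G" using h by simp
qed

lemma commutator_center_left:
  assumes z: "z \<in> center G" and g: "g \<in> carrier G" and h: "h \<in> carrier G"
  shows "commutator G (z \<otimes> g) h = commutator G g h"
proof -
  have zc: "z \<in> carrier G" and comm: "\<And>k. k \<in> carrier G \<Longrightarrow> z \<otimes> k = k \<otimes> z"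
    using z by (auto simp: center_def)
  have "z \<otimes> g \<otimes> h \<otimes> inv (z \<otimes> g) = z \<otimes> (g \<otimes> h \<otimes> inv g) \<otimes> inv z"
    using zc g h by (simp add: inv_mult_group m_assoc)
  also have "\<dots> = (g \<otimes> h \<otimes> inv g) \<otimes> z \<otimes> inv z"
    using comm[of "g \<otimes> h \<otimes> inv g"] g h by simp
  also have "\<dots> = g \<otimes> h \<otimes> inv g"
    using zc g h by (simp add: m_assoc)
  finally show ?thesis by (simp add: commutator_def)
qed

lemma inv_commutator:
  assumes "g \<in> carrier G" "h \<in> carrier G"
  shows "inv (commutator G g h) = commutator G h g"
  using assms by (simp add: commutator_def inv_mult_group m_assoc)

lemma commutator_closed:
  assumes "g \<in> carrier G" "h \<in> carrier G"
  shows "commutator G g h \<in> carrier G"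
  using assms by (simp add: commutator_def)

lemma commutator_center_right:
  assumes z: "z \<in> center G" and g: "g \<in> carrier G" and h: "h \<in> carrier G"
  shows "commutator G g (z \<otimes> h) = commutator G g h"
proof -
  have "z \<otimes> h \<in> carrier G" using z h by (auto simp: center_def)
  then have "commutator G g (z \<otimes> h) = inv (commutator G (z \<otimes> h) g)"
    using g by (simp add: inv_commutator)
  also have "\<dots> = commutator G g h"
    using z g h by (simp add: commutator_center_left inv_commutator)
  finally show ?thesis .
qed

lemma commutator_map_coset:
  assumes g: "g \<in> carrier G" and h: "h \<in> carrier G"
  shows "commutator_map G (center G #> g) (center G #> h) = commutator G g h"
  unfolding commutator_map_def
proof (rule the_equality)
  have "g \<in> center G #> g" "h \<in> center G #> h"
    using g h rcos_self[OF _ center_subgroup] by auto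
  then show "\<exists>g' \<in> center G #> g. \<exists>h' \<in> center G #> h. commutator G g h = commutator G g' h'"
    by blast
next
  fix c assume "\<exists>g' \<in> center G #> g. \<exists>h' \<in> center G #> h. c = commutator G g' h'"
  then obtain z w where z: "z \<in> center G" and w: "w \<in> center G"
    and c: "c = commutator G (z \<otimes> g) (w \<otimes> h)"
    by (auto simp: r_coset_def)
  have "w \<otimes> h \<in> carrier G" using w h by (auto simp: center_def)
  then show "c = commutator G g h"
    using c z w g h by (simp add: commutator_center_left commutator_center_right)
qed

end

end

theory Submission
  imports Defs
begin

text \<open>
  Since $x g x^{-1} = [x, g] g$, right translation by $g$ matches the conjugacy class of $g$ with
  the set of commutators $[x, g]$, $x \in G$. The size of that set is determined by the commutator
  map on $\overline{G}$ and by the coset $Y$ of $g$ alone; call it $c_G(Y)$. The number of conjugate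
  pairs in $G$ is therefore $\sum_g c_G(g Z(G)) = |Z(G)| \sum_Y c_G(Y)$, and dividing by $|G|$ gives
  \[ \kappa(G) |G| = \frac{1}{|\overline{G}|} \sum_{Y \in \overline{G}} c_G(Y), \]
  the average of $c_G$ over the central quotient (lemma \<open>kappa_order_eq_average\<close>).

  The right-hand side is visibly an isoclinism invariant: $\alpha$ permits reindexing the average
  from $\overline{G}$ to $\overline{H}$, and $c_H(\alpha(Y)) = c_G(Y)$ because the injection
  $\beta$ carries the values of $f_G(\cdot, Y)$ to those of $f_H(\cdot, \alpha(Y))$.
\<close>

definition commutator_count :: "('a, 'c) monoid_scheme \<Rightarrow> 'a set \<Rightarrow> nat" where
  "commutator_count G Y = card ((\<lambda>X. commutator_map G X Y) ` carrier (center_quotient G))"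

lemma carrier_center_quotient:
  "carrier (center_quotient G) = (\<lambda>g. center G #>\<^bsub>G\<^esub> g) ` carrier G"
  by (auto simp: FactGroup_def RCOSETS_def)

lemma pair_pmf_of_set:
  assumes "finite A" "A \<noteq> {}" "finite B" "B \<noteq> {}"
  shows "pair_pmf (pmf_of_set A) (pmf_of_set B) = pmf_of_set (A \<times> B)"
proof (rule pmf_eqI)
  fix p
  show "pmf (pair_pmf (pmf_of_set A) (pmf_of_set B)) p = pmf (pmf_of_set (A \<times> B)) p"
    using assms by (cases p) (simp add: pmf_pair indicator_def card_cartesian_product)
qed

lemma kappa_eq_card:
  assumes "finite (carrier G)" "carrier G \<noteq> {}"
  shows "kappa G = (\<Sum>g\<in>carrier G. real (card {h \<in> carrier G. conjugate G g h})) / real (order G) ^ 2"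
proof -
  let ?C = "Sigma (carrier G) (\<lambda>g. {h \<in> carrier G. conjugate G g h})"
  have "kappa G = measure_pmf.prob (pmf_of_set (carrier G \<times> carrier G)) {(g, h). conjugate G g h}"
    using assms by (simp add: kappa_def pair_pmf_of_set)
  also have "\<dots> = real (card (carrier G \<times> carrier G \<inter> {(g, h). conjugate G g h}))
                  / real (card (carrier G \<times> carrier G))"
    using assms by (subst measure_pmf_of_set) auto
  also have "carrier G \<times> carrier G \<inter> {(g, h). conjugate G g h} = ?C"
    by auto
  also have "card ?C = (\<Sum>g\<in>carrier G. card {h \<in> carrier G. conjugate G g h})"
    using assms(1) by (intro card_SigmaI) auto
  finally show ?thesis
    by (simp add: card_cartesian_product order_def power2_eq_square)
qed

context group
begin

lemma commutator_in_derived: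
  assumes "g \<in> carrier G" "h \<in> carrier G"
  shows "commutator G g h \<in> derived G (carrier G)"
  unfolding derived_def commutator_def
  by (rule generate.incl) (use assms in blast)

lemma commutator_mult_eq_conj:
  assumes "x \<in> carrier G" "g \<in> carrier G"
  shows "commutator G x g \<otimes> g = x \<otimes> g \<otimes> inv x"
  using assms by (simp add: commutator_def m_assoc)

text \<open>
  Right translation by $g$ is injective and sends $[x, g]$ to $x g x^{-1}$, so it maps the
  commutators with $g$ onto the conjugacy class of $g$.
\<close>
lemma card_conjugates:
  assumes g: "g \<in> carrier G"
  shows "card {h \<in> carrier G. conjugate G g h} = commutator_count G (center G #> g)"
proof -
  have value_set: "(\<lambda>X. commutator_map G X (center G #> g)) ` carrier (center_quotient G)
      = (\<lambda>x. commutator G x g) ` carrier G"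
    using g by (auto simp: carrier_center_quotient image_image commutator_map_coset)
  have "{h \<in> carrier G. conjugate G g h} = (\<lambda>x. x \<otimes> g \<otimes> inv x) ` carrier G"
    using g by (auto simp: conjugate_def)
  also have "\<dots> = (\<lambda>c. c \<otimes> g) ` (\<lambda>x. commutator G x g) ` carrier G"
    using g by (auto simp: image_image commutator_mult_eq_conj)
  also have "card \<dots> = card ((\<lambda>x. commutator G x g) ` carrier G)"
    using g by (intro card_image inj_onI) (auto simp: commutator_closed)
  finally show ?thesis
    by (simp add: commutator_count_def value_set)
qed

lemma sum_over_rcosets:
  fixes c :: "'a set \<Rightarrow> real"
  assumes K: "subgroup K G" and fin: "finite (carrier G)"
  shows "(\<Sum>g\<in>carrier G. c (K #> g)) = real (card K) * (\<Sum>Y\<in>rcosets K. c Y)"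
proof -
  have "(\<Sum>g\<in>carrier G. c (K #> g)) = (\<Sum>g\<in>\<Union>(rcosets K). c (K #> g))"
    by (simp add: rcosets_part_G[OF K])
  also have "\<dots> = (\<Sum>Y\<in>rcosets K. \<Sum>g\<in>Y. c (K #> g))"
    using rcos_disjoint[OF K] cosets_finite[OF _ subgroup.subset[OF K] fin]
    by (subst sum.Union_disjoint) (auto simp: pairwise_def disjnt_def)
  also have "\<dots> = (\<Sum>Y\<in>rcosets K. real (card K) * c Y)"
  proof (rule sum.cong[OF refl])
    fix Y assume Y: "Y \<in> rcosets K"
    then obtain a where a: "a \<in> carrier G" and Ya: "Y = K #> a"
      by (auto simp: RCOSETS_def)
    have "(\<Sum>g\<in>Y. c (K #> g)) = (\<Sum>g\<in>Y. c Y)"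
      using repr_independence[OF _ a K] Ya by (intro sum.cong) auto
    also have "\<dots> = real (card K) * c Y"
      using card_rcosets_equal[OF Y subgroup.subset[OF K]] by simp
    finally show "(\<Sum>g\<in>Y. c (K #> g)) = real (card K) * c Y" .
  qed
  finally show ?thesis
    by (simp add: sum_distrib_left)
qed

lemma kappa_order_eq_average:
  assumes fin: "finite (carrier G)"
  shows "kappa G * real (order G)
    = (\<Sum>Y\<in>carrier (center_quotient G). real (commutator_count G Y))
      / real (card (carrier (center_quotient G)))"
proof -
  let ?S = "\<Sum>Y\<in>rcosets (center G). real (commutator_count G Y)"
  have pos: "order G > 0"
    using fin by (simp add: order_gt_0_iff_finite)
  have lagr: "real (order G) = real (card (rcosets (center G))) * real (card (center G))"
    using lagrange[OF center_subgroup] by (metis of_nat_mult)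
  have "kappa G = (\<Sum>g\<in>carrier G. real (commutator_count G (center G #> g))) / real (order G) ^ 2"
    using fin by (subst kappa_eq_card) (auto simp: card_conjugates)
  also have "\<dots> = real (card (center G)) * ?S / real (order G) ^ 2"
    by (subst sum_over_rcosets[OF center_subgroup fin, of "\<lambda>Y. real (commutator_count G Y)"]) simp
  finally have "kappa G * real (order G) = real (card (center G)) * ?S / real (order G)"
    using pos by (simp add: power2_eq_square)
  also have "\<dots> = ?S / real (card (rcosets (center G)))"
    using pos lagr by auto
  finally show ?thesis
    by (simp add: FactGroup_def)
qed

end

lemma isoclinism_commutator_count:
  assumes "group G"
    and \<alpha>: "bij_betw \<alpha> (carrier (center_quotient G)) (carrier (center_quotient H))"
    and \<beta>: "inj_on \<beta> (derived G (carrier G))"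
    and compat: "\<And>X. X \<in> carrier (center_quotient G) \<Longrightarrow>
      \<beta> (commutator_map G X Y) = commutator_map H (\<alpha> X) (\<alpha> Y)"
    and Y: "Y \<in> carrier (center_quotient G)"
  shows "commutator_count H (\<alpha> Y) = commutator_count G Y"
proof -
  interpret group G by fact
  let ?V = "(\<lambda>X. commutator_map G X Y) ` carrier (center_quotient G)"
  have "?V \<subseteq> derived G (carrier G)"
    using Y by (auto simp: carrier_center_quotient commutator_map_coset commutator_in_derived)
  then have "card (\<beta> ` ?V) = card ?V"
    by (rule card_image[OF inj_on_subset[OF \<beta>]])
  also have "\<beta> ` ?V = (\<lambda>X. commutator_map H (\<alpha> X) (\<alpha> Y)) ` carrier (center_quotient G)"
    using compat by (simp add: image_image)
  also have "\<dots> = (\<lambda>X. commutator_map H X (\<alpha> Y)) ` carrier (center_quotient H)"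
    by (simp add: bij_betw_imp_surj_on[OF \<alpha>, symmetric] image_image)
  finally show ?thesis
    by (simp add: commutator_count_def)
qed

theorem theorem1p2:
  fixes G :: "('a, 'c) monoid_scheme" and H :: "('b, 'd) monoid_scheme"
  assumes "group G" and "finite (carrier G)"
    and "group H" and "finite (carrier H)"
    and "isoclinic G H"
  shows "kappa G * real (order G) = kappa H * real (order H)"
proof -
  obtain \<alpha> \<beta> where "\<alpha> \<in> iso (center_quotient G) (center_quotient H)"
    and "\<beta> \<in> iso (derived_group G) (derived_group H)"
    and compat: "\<And>X Y. X \<in> carrier (center_quotient G) \<Longrightarrow> Y \<in> carrier (center_quotient G) \<Longrightarrow>
      \<beta> (commutator_map G X Y) = commutator_map H (\<alpha> X) (\<alpha> Y)"
    using assms(5) unfolding isoclinic_def by blast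
  then have \<alpha>: "bij_betw \<alpha> (carrier (center_quotient G)) (carrier (center_quotient H))"
    and \<beta>: "inj_on \<beta> (derived G (carrier G))"
    by (auto simp: iso_def bij_betw_def)
  have "(\<Sum>Y\<in>carrier (center_quotient H). real (commutator_count H Y))
      = (\<Sum>Y\<in>carrier (center_quotient G). real (commutator_count H (\<alpha> Y)))"
    by (rule sum.reindex_bij_betw[OF \<alpha>, symmetric])
  also have "\<dots> = (\<Sum>Y\<in>carrier (center_quotient G). real (commutator_count G Y))"
    using isoclinism_commutator_count[OF assms(1) \<alpha> \<beta> compat] by (intro sum.cong) auto
  finally show ?thesis
    using group.kappa_order_eq_average[OF assms(1,2)] group.kappa_order_eq_average[OF assms(3,4)]
      bij_betw_same_card[OF \<alpha>] by simp
qed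

end
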